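(* Let $n\ge 1$, $\alpha\in(0,1)$, and let $(X_t)_{t \in \mathbb{Z}_+}$ be the juggler's exclusion process on $S_n$ generated by the memoryless height distributions $(\nu_B)_{B \in S_{n-1}}$ with parameter $\alpha$, started at a nonrandom initial state $A \in S_n$. For $0 \le k \le n$ let $A_k$ be the set obtained by deleting the $k$ smallest elements from $A$, and let $\tau_k = \min A_{k-1} + 1$ for $k=1,\dots,n$. Let $\xi_1,\dots,\xi_n$ be independent random variables with $\Pr(\xi_i = m) = (1-\alpha)\alpha^m$ for $m\in\mathbb{Z}_+$. Then for every $t \in \mathbb{Z}_+$, $X_t$ has the same distribution as $$\begin{cases} A - t, & \text{if } t < \tau_1, \\ U(A_k - t, \xi_1,\dots,\xi_k), & \text{if } \tau_k \le t < \tau_{k+1} \text{ for some } 1 \le k \le n-1, \\ U(\xi_1,\dots,\xi_n), & \text{if } t \ge \tau_n. \end{cases}$$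
   Context: $\mathbb{Z}_+ = \{0,1,2,\dots\}$; $S_m$ is the set of $m$-element subsets of $\mathbb{Z}_+$; $[0,k]=\{0,1,\dots,k\}$ (empty if $k=-1$). $A-t = \{a-t: a\in A\}$; $A^* = A\setminus\{\min A\}$ for finite nonempty $A$; $B^c = \mathbb{Z}_+\setminus B$. For finite $B \subset \mathbb{Z}_+$, the memoryless distribution on $B^c$ with parameter $\alpha$ is $\nu_B(y) = (1-\alpha)\alpha^{h_B(y)}$ for $y \in B^c$ and $\nu_B(y) = 0$ for $y \in B$, where $h_B(y) = |[0,y-1]\setminus B|$. The juggler's exclusion process (JEP) with $n$ particles generated by $(\nu_B)_{B\in S_{n-1}}$ is the discrete-time Markov chain on $S_n$ with transition matrix $P(A,B) = 1$ if $0\notin A$ and $B = A-1$; $P(A,B) = \nu_{A^*-1}(y)$ if $0 \in A$ and $B = (A^*-1)\cup\{y\}$ with $y \notin A^*-1$; and $P(A,B)=0$ otherwise. For finite $A\subset\mathbb{Z}_+$, the $A$-avoiding shift is $\theta_A(x) = \min\{m \ge 0 : |[0,m]\setminus A| \ge x+1\}$, $x\in\mathbb{Z}_+$. The noncolliding union of $A$ and (possibly nondistinct) points $x_1,\dots,x_n\in\mathbb{Z}_+$ is defined recursively by $U(A,x_1) = A\cup\{\theta_A(x_1)\}$ and $U(A,x_1,\dots,x_{k+1}) = C\cup\{\theta_{C}(x_{k+1})\}$ with $C = U(A,x_1,\dots,x_k)$; and $U(x_1,\dots,x_n) = U(\emptyset,x_1,\dots,x_n)$. *)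

theory Defs
  imports "HOL-Probability.Probability"
begin

definition subsets_of_card :: "nat \<Rightarrow> nat set set" where
  "subsets_of_card m = {A. finite A \<and> card A = m}"

text \<open>
  \<open>down_shift A t\<close> is $A - t$. Subtraction on \<^typ>\<open>nat\<close> truncates; below, the shift is only
  applied to sets whose elements are all at least \<open>t\<close>, where it agrees with integer subtraction.
\<close>
definition down_shift :: "nat set \<Rightarrow> nat \<Rightarrow> nat set" where
  "down_shift A t = (\<lambda>a. a - t) ` A"

definition del_min :: "nat set \<Rightarrow> nat set" where
  "del_min A = A - {Min A}"

definition del_smallest :: "nat \<Rightarrow> nat set \<Rightarrow> nat set" where
  "del_smallest k A = (del_min ^^ k) A"

definition tau :: "nat set \<Rightarrow> nat \<Rightarrow> nat" where
  "tau A k = Min (del_smallest (k - 1) A) + 1"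

definition height :: "nat set \<Rightarrow> nat \<Rightarrow> nat" where
  "height B y = card ({0..<y} - B)"

definition memoryless :: "real \<Rightarrow> nat set \<Rightarrow> nat \<Rightarrow> real" where
  "memoryless \<alpha> B y = (if y \<in> B then 0 else (1 - \<alpha>) * \<alpha> ^ height B y)"

definition jep_trans :: "(nat set \<Rightarrow> nat \<Rightarrow> real) \<Rightarrow> nat set \<Rightarrow> nat set \<Rightarrow> real" where
  "jep_trans \<nu> A B =
    (if 0 \<notin> A then (if B = down_shift A 1 then 1 else 0)
     else let C = down_shift (del_min A) 1 in
       if \<exists>y. y \<notin> C \<and> B = C \<union> {y} then \<nu> C (THE y. y \<notin> C \<and> B = C \<union> {y}) else 0)"

text \<open>The landing position \<open>y\<close> is determined by \<open>C\<close> and \<open>C \<union> {y}\<close>, so the description is proper.\<close>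
lemma jep_trans_throw:
  assumes "0 \<in> A" and "y \<notin> down_shift (del_min A) 1"
  shows "jep_trans \<nu> A (down_shift (del_min A) 1 \<union> {y}) = \<nu> (down_shift (del_min A) 1) y"
proof -
  define C where "C = down_shift (del_min A) 1"
  have "(THE z. z \<notin> C \<and> C \<union> {y} = C \<union> {z}) = y"
    using assms(2) unfolding C_def[symmetric] by (intro the_equality) auto
  then show ?thesis
    using assms unfolding jep_trans_def C_def[symmetric] Let_def by auto
qed

text \<open>
  Discrete-time Markov chain with transition matrix \<open>P\<close> on a countable state space \<open>S\<close>, on an
  arbitrary probability space and with arbitrary initial distribution.
\<close>
definition markov_chain ::
  "'w measure \<Rightarrow> 's set \<Rightarrow> ('s \<Rightarrow> 's \<Rightarrow> real) \<Rightarrow> (nat \<Rightarrow> 'w \<Rightarrow> 's) \<Rightarrow> bool" where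
  "markov_chain M S P X \<longleftrightarrow>
    prob_space M \<and> countable S \<and>
    (\<forall>t. X t \<in> measurable M (count_space S)) \<and>
    (\<forall>t x. (\<forall>i\<le>Suc t. x i \<in> S) \<longrightarrow> \<P>(\<omega> in M. \<forall>i\<le>t. X i \<omega> = x i) > 0 \<longrightarrow>
       \<P>(\<omega> in M. X (Suc t) \<omega> = x (Suc t) \<bar> \<forall>i\<le>t. X i \<omega> = x i) = P (x t) (x (Suc t)))"

definition juggler_exclusion_process ::
  "'w measure \<Rightarrow> nat \<Rightarrow> (nat set \<Rightarrow> nat \<Rightarrow> real) \<Rightarrow> (nat \<Rightarrow> 'w \<Rightarrow> nat set) \<Rightarrow> bool" where
  "juggler_exclusion_process M n \<nu> X \<longleftrightarrow> markov_chain M (subsets_of_card n) (jep_trans \<nu>) X"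

definition avoiding_shift :: "nat set \<Rightarrow> nat \<Rightarrow> nat" where
  "avoiding_shift A x = (LEAST m. card ({0..m} - A) \<ge> x + 1)"

text \<open>
  \<open>nc_union A x k\<close> is the noncolliding union $U(A, x_1, \ldots, x_k)$; the points are
  indexed from \<open>1\<close>, and for \<open>k = 0\<close> it is \<open>A\<close>.
\<close>
primrec nc_union :: "nat set \<Rightarrow> (nat \<Rightarrow> nat) \<Rightarrow> nat \<Rightarrow> nat set" where
  "nc_union A x 0 = A"
| "nc_union A x (Suc k) = (let C = nc_union A x k in C \<union> {avoiding_shift C (x (Suc k))})"

text \<open>Equality in law of \<open>S\<close>-valued random variables, \<open>S\<close> countable, living on possibly different
  probability spaces.\<close>
definition same_distribution ::
  "'s set \<Rightarrow> 'w measure \<Rightarrow> ('w \<Rightarrow> 's) \<Rightarrow> 'v measure \<Rightarrow> ('v \<Rightarrow> 's) \<Rightarrow> bool" where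
  "same_distribution S M X N Y \<longleftrightarrow>
    X \<in> measurable M (count_space S) \<and> Y \<in> measurable N (count_space S) \<and>
    distr M (count_space S) X = distr N (count_space S) Y"

end

theory Submission imports Defs
begin

text \<open>
  The memoryless law on $B^c$ is the law of $\theta_B(\xi)$ with $\xi$ geometric, because
  $\theta_B$ enumerates $B^c$ in increasing order and $h_B$ is its inverse
  (\<open>height_avoiding_shift\<close>). So a throw of the juggler is a noncolliding insertion of a fresh
  geometric point, and the theorem says that the family of laws of
  $U(D, \xi_1, \ldots, \xi_k)$ is preserved by one step of the process, with an explicit
  change of parameters $(D, k)$. Let $D'$ be the set of all $y$ with $y + 1 \in D$.

  \<^item> If $0 \in D$, then $(D, k)$ becomes $(D', k + 1)$ (\<open>jep_step_random_fill_throw\<close>). Insertion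
    never sees the occupied site 0, so the downward shift commutes with it and turns
    $U(D, \xi_1, \ldots, \xi_k)$ into $U(D', \xi_1, \ldots, \xi_k)$. The particle
    at 0 is then thrown, which is the insertion of a $(k+1)$-st independent point.

  \<^item> If $0 \notin D$, then $(D, k)$ becomes $(D', k)$ (\<open>jep_step_random_fill_wait\<close>). This is where
    the geometric law matters, and the proof is by induction on $k$. If $\xi_1 = 0$, the first
    point fills the site 0, and the previous case, with $k - 1$ points, leads to the law of
    $U(D', \xi_1, \ldots, \xi_k)$. Otherwise $\xi_1 = \xi' + 1$ with $\xi'$ again
    geometric; the first point is placed above 0, shifting it down amounts to inserting $\xi'$ into
    $D'$, and the induction hypothesis handles the remaining $k - 1$ points. Both cases
    give the same law, hence so does their mixture.

  Started from $A$, the parameters at time $t$ are therefore the particles of $A$ at or above $t$,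
  moved down by $t$, and the number of particles of $A$ below $t$
  (\<open>jep_law_eq_random_fill\<close>). The times $\tau_k$ describe when this number changes
  (\<open>jep_law_between\<close>). What remains is to pass from random variables on arbitrary probability
  spaces to their discrete laws: \<open>jep_has_law\<close> for the chain and \<open>nc_union_has_law\<close> for the
  noncolliding unions.
\<close>

section \<open>The avoiding shift enumerates the complement\<close>

lemma height_Suc:
  "height A (Suc y) = height A y + (if y \<in> A then 0 else 1)"
proof -
  have "{0..<Suc y} - A = (if y \<in> A then {0..<y} - A else insert y ({0..<y} - A))"
    by (auto simp: less_Suc_eq)
  then show ?thesis
    unfolding height_def by simp
qed

lemma height_0 [simp]: "height A 0 = 0"
  by (simp add: height_def)

lemma height_mono: "y \<le> z \<Longrightarrow> height A y \<le> height A z"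
  unfolding height_def by (intro card_mono) auto

text \<open>
  Counting free sites in \<open>{0..m}\<close> is taking the height of \<open>Suc m\<close>; in this form the defining minimum
  can be found from the monotonicity of the height.
\<close>
lemma avoiding_shift_height: "avoiding_shift A x = (LEAST m. x < height A (Suc m))"
  unfolding avoiding_shift_def height_def
  by (simp add: atLeastLessThanSuc_atLeastAtMost Suc_le_eq)

text \<open>
  The height is strictly increasing on the complement of \<open>A\<close>, so its value determines the site.
  All values of the avoiding shift below are computed with this rule.
\<close>
lemma avoiding_shift_eqI:
  assumes "y \<notin> A" and "height A y = x"
  shows "avoiding_shift A x = y"
  unfolding avoiding_shift_height
proof (rule Least_equality)
  show "x < height A (Suc y)"
    using assms by (simp add: height_Suc)
next
  fix m assume "x < height A (Suc m)"
  then show "y \<le> m"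
    using height_mono[of "Suc m" y A] assms(2) by (meson leD leI Suc_leI)
qed

text \<open>
  The height of \<open>Suc m\<close> exceeds that of \<open>m\<close> by one if \<open>m\<close> is free and equals it otherwise; as
  \<open>A\<close> is finite, the height is unbounded. Hence it first exceeds \<open>x\<close> just after a free site of
  height \<open>x\<close>.
\<close>
lemma
  assumes "finite A"
  shows avoiding_shift_notin: "avoiding_shift A x \<notin> A"
    and height_avoiding_shift: "height A (avoiding_shift A x) = x"
proof -
  let ?m = "avoiding_shift A x"
  have "Suc (x + card A) - card A \<le> card ({0..<Suc (x + card A)} - A)"
    using diff_card_le_card_Diff[OF assms, of "{0..<Suc (x + card A)}"] by simp
  then have "x < height A (Suc (x + card A))"
    unfolding height_def by simp
  then have upper: "x < height A (Suc ?m)"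
    unfolding avoiding_shift_height by (rule LeastI)
  have lower: "height A ?m \<le> x"
  proof (cases ?m)
    case (Suc k)
    then show ?thesis
      using not_less_Least[of k "\<lambda>m. x < height A (Suc m)"]
      by (simp add: avoiding_shift_height)
  qed simp
  show "?m \<notin> A" and "height A ?m = x"
    using upper lower by (auto simp: height_Suc split: if_splits)
qed

section \<open>Noncolliding insertion and the shift\<close>

definition occupy :: "nat set \<Rightarrow> nat \<Rightarrow> nat set" where
  "occupy A x = insert (avoiding_shift A x) A"

text \<open>
  A preimage, so a particle at 0 disappears: this gives both $A - 1$ for $0 \notin A$ and
  $A^* - 1$ for $0 \in A$.
\<close>
definition drop_by_one :: "nat set \<Rightarrow> nat set" where
  "drop_by_one A = Suc -` A"

lemma mem_drop_by_one [simp]: "y \<in> drop_by_one A \<longleftrightarrow> Suc y \<in> A"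
  by (simp add: drop_by_one_def)

lemma finite_drop_by_one: "finite A \<Longrightarrow> finite (drop_by_one A)"
  unfolding drop_by_one_def by (intro finite_vimageI) auto

lemma down_shift_1:
  assumes "0 \<notin> A"
  shows "down_shift A 1 = drop_by_one A"
proof (rule set_eqI)
  fix y
  have "y = a - 1 \<longleftrightarrow> a = Suc y" if "a \<in> A" for a
    using that assms by (cases a) auto
  then have "(\<exists>a\<in>A. y = a - 1) \<longleftrightarrow> Suc y \<in> A"
    by metis
  then show "y \<in> down_shift A 1 \<longleftrightarrow> y \<in> drop_by_one A"
    by (simp add: down_shift_def image_iff)
qed

lemma down_shift_del_min: "0 \<in> A \<Longrightarrow> finite A \<Longrightarrow> down_shift (del_min A) 1 = drop_by_one A"
proof -
  assume "0 \<in> A" "finite A"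
  then have "Min A = 0"
    by (metis Min_le le_zero_eq)
  then have "del_min A = A - {0}"
    by (simp add: del_min_def)
  moreover have "drop_by_one (A - {0}) = drop_by_one A"
    by auto
  ultimately show ?thesis
    by (metis down_shift_1 Diff_iff singletonI)
qed

lemma finite_occupy [simp]: "finite (occupy A x) \<longleftrightarrow> finite A"
  by (simp add: occupy_def)

lemma card_occupy: "finite A \<Longrightarrow> card (occupy A x) = Suc (card A)"
  by (simp add: occupy_def avoiding_shift_notin)

lemma finite_foldl_occupy [simp]: "finite (foldl occupy A xs) \<longleftrightarrow> finite A"
  by (induction xs arbitrary: A) auto

lemma card_foldl_occupy: "finite A \<Longrightarrow> card (foldl occupy A xs) = card A + length xs"
  by (induction xs arbitrary: A) (auto simp: card_occupy)

lemma subset_foldl_occupy: "A \<subseteq> foldl occupy A xs"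
proof (induction xs arbitrary: A)
  case (Cons x xs)
  have "A \<subseteq> occupy A x"
    by (auto simp: occupy_def)
  with Cons[of "occupy A x"] show ?case
    by simp
qed simp

lemma inj_occupy: "finite A \<Longrightarrow> inj (occupy A)"
  by (rule injI) (metis occupy_def avoiding_shift_notin height_avoiding_shift insert_ident insert_iff)

lemma height_drop_by_one:
  "height A (Suc y) = height (drop_by_one A) y + (if 0 \<in> A then 0 else 1)"
  by (induction y) (auto simp: height_Suc)

text \<open>
  An occupied site 0 does not contribute to any height, so removing it does not affect where the
  point goes.
\<close>
lemma drop_by_one_occupy:
  assumes "finite A" and "0 \<in> A"
  shows "drop_by_one (occupy A x) = occupy (drop_by_one A) x"
proof -
  let ?y = "avoiding_shift (drop_by_one A) x"
  have "avoiding_shift A x = Suc ?y"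
    using assms avoiding_shift_notin[of "drop_by_one A" x] height_avoiding_shift[of "drop_by_one A" x]
    by (intro avoiding_shift_eqI) (auto simp: finite_drop_by_one height_drop_by_one)
  then show ?thesis
    by (auto simp: occupy_def)
qed

lemma occupy_0: "0 \<notin> A \<Longrightarrow> occupy A 0 = insert 0 A"
  by (simp add: occupy_def avoiding_shift_eqI)

text \<open>
  A free site 0 takes up exactly the first free place, so a point \<open>Suc x\<close> lands above it and
  becomes the point \<open>x\<close> after the shift.
\<close>
lemma
  assumes "finite A" and "0 \<notin> A"
  shows drop_by_one_occupy_Suc: "drop_by_one (occupy A (Suc x)) = occupy (drop_by_one A) x"
    and zero_notin_occupy_Suc: "0 \<notin> occupy A (Suc x)"
proof -
  let ?y = "avoiding_shift (drop_by_one A) x"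
  have "avoiding_shift A (Suc x) = Suc ?y"
    using assms avoiding_shift_notin[of "drop_by_one A" x] height_avoiding_shift[of "drop_by_one A" x]
    by (intro avoiding_shift_eqI) (auto simp: finite_drop_by_one height_drop_by_one)
  then show "drop_by_one (occupy A (Suc x)) = occupy (drop_by_one A) x"
    and "0 \<notin> occupy A (Suc x)"
    using assms by (auto simp: occupy_def)
qed

lemma drop_by_one_foldl_occupy:
  assumes "finite A" and "0 \<in> A"
  shows "drop_by_one (foldl occupy A xs) = foldl occupy (drop_by_one A) xs"
  using assms
proof (induction xs arbitrary: A)
  case (Cons x xs)
  have "0 \<in> occupy A x"
    using Cons.prems by (simp add: occupy_def)
  then show ?case
    using Cons by (simp add: drop_by_one_occupy)
qed simp

section \<open>One step of the process applied to a random filling\<close>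

text \<open>
  The law of $U(A, \xi_1, \ldots, \xi_k)$ for independent $\xi_i$ with law \<open>g\<close>.
\<close>
definition random_fill :: "nat pmf \<Rightarrow> nat set \<Rightarrow> nat \<Rightarrow> nat set pmf" where
  "random_fill g A k = map_pmf (foldl occupy A) (replicate_pmf k g)"

text \<open>
  The transition kernel in sampling form: the thrown particle is inserted with a fresh point of
  law \<open>g\<close>.
\<close>
definition jep_step :: "nat pmf \<Rightarrow> nat set \<Rightarrow> nat set pmf" where
  "jep_step g A =
    (if 0 \<in> A then map_pmf (occupy (drop_by_one A)) g else return_pmf (drop_by_one A))"

lemma random_fill_0 [simp]: "random_fill g A 0 = return_pmf A"
  by (simp add: random_fill_def)

lemma random_fill_Suc_first:
  "random_fill g A (Suc k) = bind_pmf g (\<lambda>x. random_fill g (occupy A x) k)"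
  by (simp add: random_fill_def map_bind_pmf map_pmf_def bind_assoc_pmf bind_return_pmf)

lemma random_fill_Suc_last:
  "random_fill g A (Suc k) = bind_pmf (random_fill g A k) (\<lambda>C. map_pmf (occupy C) g)"
  using replicate_pmf_distrib[of k 1 g]
  by (simp add: random_fill_def map_bind_pmf map_pmf_def bind_assoc_pmf bind_return_pmf)

lemma random_fill_card:
  "finite A \<Longrightarrow> B \<in> set_pmf (random_fill g A k) \<Longrightarrow> finite B \<and> card B = card A + k"
  by (auto simp: random_fill_def set_replicate_pmf card_foldl_occupy)

text \<open>
  Every filling of \<open>A\<close> still contains 0, so the juggler throws for sure. The shift commutes with
  the \<open>k\<close> insertions, and the throw supplies the last one.
\<close>
lemma jep_step_random_fill_throw:
  assumes "finite A" and "0 \<in> A"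
  shows "bind_pmf (random_fill g A k) (jep_step g) = random_fill g (drop_by_one A) (Suc k)"
proof -
  have "jep_step g (foldl occupy A xs) = map_pmf (occupy (foldl occupy (drop_by_one A) xs)) g" for xs
    using subset_foldl_occupy[of A xs] assms by (auto simp: jep_step_def drop_by_one_foldl_occupy)
  then show ?thesis
    unfolding random_fill_Suc_last by (simp add: random_fill_def bind_map_pmf)
qed

text \<open>
  Lack of memory: a geometric variable is 0 with probability \<open>p\<close>, and given that it is positive,
  its predecessor is geometric again.
\<close>
lemma geometric_bind_split:
  assumes "0 < p" and "p \<le> 1"
  shows "bind_pmf (geometric_pmf p) f = bind_pmf (bernoulli_pmf p)
    (\<lambda>b. if b then f 0 else bind_pmf (geometric_pmf p) (\<lambda>x. f (Suc x)))"
proof -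
  have "p \<in> {0<..1}"
    using assms by simp
  from geometric_bind_pmf_unfold[OF this]
  have "bind_pmf (geometric_pmf p) f = bind_pmf (bernoulli_pmf p
      \<bind> (\<lambda>b. if b then return_pmf 0 else map_pmf Suc (geometric_pmf p))) f"
    by simp
  also have "\<dots> = bind_pmf (bernoulli_pmf p)
    (\<lambda>b. if b then f 0 else bind_pmf (geometric_pmf p) (\<lambda>x. f (Suc x)))"
    unfolding bind_assoc_pmf
    by (intro bind_pmf_cong) (auto simp: bind_return_pmf bind_map_pmf)
  finally show ?thesis .
qed

text \<open>
  Conditioning on the first point \<open>x\<close>: for \<open>x = 0\<close> it occupies the site 0 and is thrown anew as the
  last point; for \<open>x > 0\<close> it merely moves down with the configuration. By lack of memory both
  alternatives lead to the same law.
\<close>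
lemma jep_step_random_fill_wait:
  assumes p: "0 < p" "p \<le> 1" and "finite A" and "0 \<notin> A"
  shows "bind_pmf (random_fill (geometric_pmf p) A k) (jep_step (geometric_pmf p)) =
    random_fill (geometric_pmf p) (drop_by_one A) k"
  using assms(3,4)
proof (induction k arbitrary: A)
  case 0
  then show ?case
    by (simp add: bind_return_pmf jep_step_def)
next
  case (Suc k)
  let ?g = "geometric_pmf p"
  have zero: "bind_pmf (random_fill ?g (occupy A 0) k) (jep_step ?g) =
      random_fill ?g (drop_by_one A) (Suc k)"
  proof -
    have "drop_by_one (insert 0 A) = drop_by_one A"
      by auto
    then show ?thesis
      using Suc.prems jep_step_random_fill_throw[of "insert 0 A" ?g k] by (simp add: occupy_0)
  qed
  have positive: "bind_pmf (random_fill ?g (occupy A (Suc x)) k) (jep_step ?g) =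
      random_fill ?g (occupy (drop_by_one A) x) k" for x
    using Suc.prems Suc.IH[of "occupy A (Suc x)"]
    by (simp add: drop_by_one_occupy_Suc zero_notin_occupy_Suc)
  have "bind_pmf (random_fill ?g A (Suc k)) (jep_step ?g) =
      bind_pmf ?g (\<lambda>x. bind_pmf (random_fill ?g (occupy A x) k) (jep_step ?g))"
    by (simp add: random_fill_Suc_first bind_assoc_pmf)
  also have "\<dots> = bind_pmf (bernoulli_pmf p) (\<lambda>b.
      if b then random_fill ?g (drop_by_one A) (Suc k)
      else bind_pmf ?g (\<lambda>x. random_fill ?g (occupy (drop_by_one A) x) k))"
    by (subst geometric_bind_split[OF p]) (simp add: zero positive cong: if_cong)
  also have "\<dots> = random_fill ?g (drop_by_one A) (Suc k)"
    by (simp add: random_fill_Suc_first[symmetric] if_distrib cong: if_cong)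
  finally show ?case .
qed

section \<open>The law of the chain\<close>

primrec jep_law :: "nat pmf \<Rightarrow> nat set \<Rightarrow> nat \<Rightarrow> nat set pmf" where
  "jep_law g A 0 = return_pmf A"
| "jep_law g A (Suc t) = bind_pmf (jep_law g A t) (jep_step g)"

text \<open>
  At time \<open>t\<close> the particles of \<open>A\<close> below \<open>t\<close> have been thrown at least once, and the others have only
  fallen. The particle at \<open>t\<close>, if there is one, is at 0 in the deterministic part, which decides
  between the two step lemmas.
\<close>
lemma jep_law_eq_random_fill:
  assumes p: "0 < p" "p \<le> 1" and A: "finite A"
  shows "jep_law (geometric_pmf p) A t =
    random_fill (geometric_pmf p) (down_shift {a \<in> A. t \<le> a} t) (card {a \<in> A. a < t})"
proof (induction t)
  case 0
  then show ?case
    by (simp add: down_shift_def)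
next
  case (Suc t)
  let ?D = "down_shift {a \<in> A. t \<le> a} t"
  have fin: "finite ?D"
    using A by (simp add: down_shift_def)
  have mem: "y \<in> down_shift {a \<in> A. s \<le> a} s \<longleftrightarrow> y + s \<in> A" for y s
    by (force simp: down_shift_def)
  have drop: "drop_by_one ?D = down_shift {a \<in> A. Suc t \<le> a} (Suc t)"
    by (rule set_eqI) (simp only: mem_drop_by_one mem add_Suc add_Suc_right)
  have count: "card {a \<in> A. a < Suc t} = (if t \<in> A then Suc else id) (card {a \<in> A. a < t})"
  proof -
    have "{a \<in> A. a < Suc t} = (if t \<in> A then insert t {a \<in> A. a < t} else {a \<in> A. a < t})"
      by (auto simp: less_Suc_eq)
    then show ?thesis
      using A by simp
  qed
  have "0 \<in> ?D \<longleftrightarrow> t \<in> A"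
    by (simp add: mem)
  then show ?case
    using Suc fin by (simp add: count drop[symmetric] jep_step_random_fill_throw
        jep_step_random_fill_wait[OF p])
qed

text \<open>
  Insertion is injective in the point, so the probability of landing at \<open>y\<close> is the geometric
  weight of the single point that lands there, which is the height of \<open>y\<close>.
\<close>
lemma jep_trans_eq_pmf_jep_step:
  assumes "0 < \<alpha>" "\<alpha> < 1" and "finite A"
  shows "jep_trans (memoryless \<alpha>) A B = pmf (jep_step (geometric_pmf (1 - \<alpha>)) A) B"
proof (cases "0 \<in> A")
  case False
  then show ?thesis
    using down_shift_1[OF False]
    by (auto simp: jep_trans_def jep_step_def)
next
  case True
  let ?C = "drop_by_one A" and ?g = "geometric_pmf (1 - \<alpha>)"
  have C: "down_shift (del_min A) 1 = ?C"
    using True assms(3) by (rule down_shift_del_min)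
  have fin: "finite ?C"
    using assms(3) by (rule finite_drop_by_one)
  show ?thesis
  proof (cases "\<exists>y. y \<notin> ?C \<and> B = ?C \<union> {y}")
    case True': True
    then obtain y where y: "y \<notin> ?C" "B = ?C \<union> {y}"
      by blast
    have "B = occupy ?C (height ?C y)"
      using y by (auto simp: occupy_def avoiding_shift_eqI)
    then have "pmf (jep_step ?g A) B = pmf ?g (height ?C y)"
      using True inj_occupy[OF fin] by (simp add: jep_step_def pmf_map_inj')
    also have "\<dots> = memoryless \<alpha> ?C y"
      using y assms by (simp add: memoryless_def)
    finally show ?thesis
      using jep_trans_throw[OF True, of y "memoryless \<alpha>"] y unfolding C by simp
  next
    case False
    have "B \<notin> set_pmf (jep_step ?g A)"
    proof
      assume "B \<in> set_pmf (jep_step ?g A)"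
      then obtain x where "B = occupy ?C x"
        using True by (auto simp: jep_step_def)
      then show False
        using False avoiding_shift_notin[OF fin] by (auto simp: occupy_def)
    qed
    then show ?thesis
      using True False unfolding jep_trans_def C Let_def if_not_P[OF False] by (simp add: set_pmf_iff)
  qed
qed

section \<open>Random variables with a given discrete law\<close>

text \<open>
  Only the point masses in \<open>S\<close> are prescribed: for countable \<open>S\<close> they determine the law, also when
  the type of the states is uncountable, as for sets of natural numbers.
\<close>
definition has_law :: "'w measure \<Rightarrow> 's set \<Rightarrow> ('w \<Rightarrow> 's) \<Rightarrow> 's pmf \<Rightarrow> bool" where
  "has_law M S Y p \<longleftrightarrow> Y \<in> measurable M (count_space S) \<and>
    (\<forall>b\<in>S. emeasure M {\<omega> \<in> space M. Y \<omega> = b} = pmf p b)"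

lemma same_distribution_if_has_law:
  assumes "countable S" and X: "has_law M S X p" and Y: "has_law N S Y p"
  shows "same_distribution S M X N Y"
proof -
  have "distr M (count_space S) X = distr N (count_space S) Y"
  proof (rule measure_eqI_countable[OF _ _ assms(1)])
    fix b assume "b \<in> S"
    moreover have "X -` {b} \<inter> space M = {\<omega> \<in> space M. X \<omega> = b}"
      "Y -` {b} \<inter> space N = {\<omega> \<in> space N. Y \<omega> = b}"
      by auto
    ultimately show "emeasure (distr M (count_space S) X) {b} = emeasure (distr N (count_space S) Y) {b}"
      using X Y by (simp add: has_law_def emeasure_distr)
  qed auto
  then show ?thesis
    using X Y by (simp add: same_distribution_def has_law_def)
qed

lemma emeasure_partition:
  assumes "countable I" and "\<And>i. i \<in> I \<Longrightarrow> {\<omega> \<in> space M. Q i \<omega>} \<in> sets M"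
    and "\<And>\<omega>. \<omega> \<in> space M \<Longrightarrow> R \<omega> \<longleftrightarrow> (\<exists>i\<in>I. Q i \<omega>)"
    and "\<And>\<omega> i j. i \<in> I \<Longrightarrow> j \<in> I \<Longrightarrow> Q i \<omega> \<Longrightarrow> Q j \<omega> \<Longrightarrow> i = j"
  shows "emeasure M {\<omega> \<in> space M. R \<omega>} = (\<integral>\<^sup>+i. emeasure M {\<omega> \<in> space M. Q i \<omega>} \<partial>count_space I)"
proof -
  have "{\<omega> \<in> space M. R \<omega>} = (\<Union>i\<in>I. {\<omega> \<in> space M. Q i \<omega>})"
    using assms(3) by auto
  moreover have "disjoint_family_on (\<lambda>i. {\<omega> \<in> space M. Q i \<omega>}) I"
    unfolding disjoint_family_on_def using assms(4) by blast
  ultimately show ?thesis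
    using assms(1,2) by (simp add: emeasure_UN_countable)
qed

text \<open>
  The Markov property prescribes transition probabilities only given an entire past of positive
  probability. Summing over the countably many pasts that end in \<open>a\<close> gives the transition from the
  present state alone; pasts of probability zero contribute nothing to either side.
\<close>
lemma markov_chain_transition:
  assumes chain: "markov_chain M S P X" and a: "a \<in> S" and b: "b \<in> S"
    and nonneg: "0 \<le> P a b"
  shows "emeasure M {\<omega> \<in> space M. X t \<omega> = a \<and> X (Suc t) \<omega> = b} =
    emeasure M {\<omega> \<in> space M. X t \<omega> = a} * ennreal (P a b)"
proof -
  interpret prob_space M
    using chain by (simp add: markov_chain_def)
  have cS: "countable S" and meas [measurable]: "\<And>t. X t \<in> measurable M (count_space S)"
    using chain by (auto simp: markov_chain_def)
  have inS: "X i \<omega> \<in> S" if "\<omega> \<in> space M" for i \<omega>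
    using measurable_space[OF meas that] by simp
  have sets1: "{\<omega> \<in> space M. X i \<omega> = c} \<in> sets M" if "c \<in> S" for i c
    using measurable_sets[OF meas, of "{c}" i] that
    by (simp add: vimage_def Int_def conj_commute)
  \<comment> \<open>Pasts are encoded as lists, of which there are only countably many over \<open>S\<close>.\<close>
  define H where "H = {h \<in> lists S. length h = Suc t \<and> h ! t = a}"
  have cH: "countable H"
    unfolding H_def by (rule countable_subset[OF _ countable_lists[OF cS]]) auto
  define past where "past = (\<lambda>h \<omega>. \<forall>i\<le>t. X i \<omega> = h ! i)"
  have hS: "h ! i \<in> S" if "h \<in> H" "i \<le> t" for h i
    using that by (auto simp: H_def in_lists_conv_set intro!: nth_mem)
  have sets_past: "{\<omega> \<in> space M. past h \<omega>} \<in> sets M" if "h \<in> H" for h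
  proof -
    have "{\<omega> \<in> space M. past h \<omega>} = {\<omega> \<in> space M. \<forall>i\<in>{..t}. X i \<omega> = h ! i}"
      by (auto simp: past_def)
    also have "\<dots> \<in> sets M"
      using hS[OF that] by (intro sets.sets_Collect_finite_All sets1) auto
    finally show ?thesis .
  qed
  have sets_next: "{\<omega> \<in> space M. past h \<omega> \<and> X (Suc t) \<omega> = b} \<in> sets M" if "h \<in> H" for h
  proof -
    have "{\<omega> \<in> space M. past h \<omega> \<and> X (Suc t) \<omega> = b} =
        {\<omega> \<in> space M. past h \<omega>} \<inter> {\<omega> \<in> space M. X (Suc t) \<omega> = b}"
      by auto
    then show ?thesis
      using sets_past[OF that] sets1[OF b] by simp
  qed
  have list_of_path: "\<exists>h\<in>H. past h \<omega>" if "\<omega> \<in> space M" "X t \<omega> = a" for \<omega>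
  proof (rule bexI)
    show "past (map (\<lambda>i. X i \<omega>) [0..<Suc t]) \<omega>"
      by (simp add: past_def nth_append less_Suc_eq_le del: upt_Suc)
    show "map (\<lambda>i. X i \<omega>) [0..<Suc t] \<in> H"
      using that inS by (auto simp: H_def simp del: upt_Suc)
  qed
  have past_unique: "h = h'" if "h \<in> H" "h' \<in> H" "past h \<omega>" "past h' \<omega>" for h h' \<omega>
    using that by (auto simp: H_def past_def less_Suc_eq_le intro!: nth_equalityI)
  have past_now: "X t \<omega> = a" if "h \<in> H" "past h \<omega>" for h \<omega>
    using that by (simp add: H_def past_def)
  have step: "emeasure M {\<omega> \<in> space M. past h \<omega> \<and> X (Suc t) \<omega> = b} =
      emeasure M {\<omega> \<in> space M. past h \<omega>} * ennreal (P a b)" if h: "h \<in> H" for h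
  proof (cases "prob {\<omega> \<in> space M. past h \<omega>} = 0")
    case True
    then have "emeasure M {\<omega> \<in> space M. past h \<omega>} = 0"
      by (simp add: emeasure_eq_measure)
    moreover from this have "emeasure M {\<omega> \<in> space M. past h \<omega> \<and> X (Suc t) \<omega> = b} = 0"
      by (rule emeasure_eq_0[OF sets_past[OF h]]) auto
    ultimately show ?thesis
      by simp
  next
    case False
    \<comment> \<open>The past extended by the next state, in the form that the Markov property expects.\<close>
    define x where "x = (\<lambda>i. if i \<le> t then h ! i else b)"
    have past_x: "(\<forall>i\<le>t. X i \<omega> = x i) \<longleftrightarrow> past h \<omega>" for \<omega>
      by (auto simp: past_def x_def)
    have "(\<forall>i\<le>Suc t. x i \<in> S) \<longrightarrow> \<P>(\<omega> in M. \<forall>i\<le>t. X i \<omega> = x i) > 0 \<longrightarrow>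
        \<P>(\<omega> in M. X (Suc t) \<omega> = x (Suc t) \<bar> \<forall>i\<le>t. X i \<omega> = x i) = P (x t) (x (Suc t))"
      using chain unfolding markov_chain_def by blast
    moreover note past_x
    moreover have "\<forall>i\<le>Suc t. x i \<in> S"
      using hS[OF h] b by (simp add: x_def)
    moreover have "0 < prob {\<omega> \<in> space M. past h \<omega>}"
      using False by (simp add: zero_less_measure_iff)
    moreover have "x t = a" "x (Suc t) = b"
      using h by (auto simp: x_def H_def)
    ultimately have "\<P>(\<omega> in M. X (Suc t) \<omega> = b \<bar> past h \<omega>) = P a b"
      by simp
    then have "prob {\<omega> \<in> space M. X (Suc t) \<omega> = b \<and> past h \<omega>} =
        prob {\<omega> \<in> space M. past h \<omega>} * P a b"
      using False by (simp add: cond_prob_def field_simps)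
    then show ?thesis
      using nonneg by (simp add: emeasure_eq_measure conj_commute ennreal_mult)
  qed
  have "emeasure M {\<omega> \<in> space M. X t \<omega> = a \<and> X (Suc t) \<omega> = b} =
      (\<integral>\<^sup>+h. emeasure M {\<omega> \<in> space M. past h \<omega> \<and> X (Suc t) \<omega> = b} \<partial>count_space H)"
    using list_of_path past_now past_unique by (intro emeasure_partition cH sets_next) blast+
  also have "\<dots> = (\<integral>\<^sup>+h. emeasure M {\<omega> \<in> space M. past h \<omega>} * ennreal (P a b) \<partial>count_space H)"
    by (intro nn_integral_cong) (simp add: step)
  also have "\<dots> = (\<integral>\<^sup>+h. emeasure M {\<omega> \<in> space M. past h \<omega>} \<partial>count_space H) * ennreal (P a b)"
    by (rule nn_integral_multc) simp
  also have "(\<integral>\<^sup>+h. emeasure M {\<omega> \<in> space M. past h \<omega>} \<partial>count_space H) =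
      emeasure M {\<omega> \<in> space M. X t \<omega> = a}"
    using list_of_path past_now past_unique
    by (intro emeasure_partition[symmetric] cH sets_past) blast+
  finally show ?thesis .
qed

lemma markov_chain_has_law_Suc:
  assumes chain: "markov_chain M S P X" and law: "has_law M S (X t) p"
    and p: "set_pmf p \<subseteq> S"
    and kernel: "\<And>a b. a \<in> S \<Longrightarrow> b \<in> S \<Longrightarrow> P a b = pmf (K a) b"
  shows "has_law M S (X (Suc t)) (bind_pmf p K)"
proof -
  have cS: "countable S" and meas: "\<And>t. X t \<in> measurable M (count_space S)"
    using chain by (auto simp: markov_chain_def)
  have inS: "X i \<omega> \<in> S" if "\<omega> \<in> space M" for i \<omega>
    using measurable_space[OF meas that] by simp
  have sets1: "{\<omega> \<in> space M. X i \<omega> = c} \<in> sets M" if "c \<in> S" for i c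
    using measurable_sets[OF meas, of "{c}" i] that
    by (simp add: vimage_def Int_def conj_commute)
  have "emeasure M {\<omega> \<in> space M. X (Suc t) \<omega> = b} = pmf (bind_pmf p K) b" if b: "b \<in> S" for b
  proof -
    have "emeasure M {\<omega> \<in> space M. X (Suc t) \<omega> = b} =
        (\<integral>\<^sup>+a. emeasure M {\<omega> \<in> space M. X t \<omega> = a \<and> X (Suc t) \<omega> = b} \<partial>count_space S)"
      using inS by (intro emeasure_partition cS sets.sets_Collect_conj sets1 b) auto
    also have "\<dots> = (\<integral>\<^sup>+a. pmf p a * ennreal (pmf (K a) b) \<partial>count_space S)"
      using law b by (intro nn_integral_cong)
        (simp add: markov_chain_transition[OF chain] kernel has_law_def)
    also have "\<dots> = (\<integral>\<^sup>+a. pmf p a * ennreal (pmf (K a) b) \<partial>count_space UNIV)"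
      using p by (intro nn_integral_count_space_eq) (auto simp: set_pmf_iff)
    also have "\<dots> = pmf (bind_pmf p K) b"
      by (simp add: ennreal_pmf_bind nn_integral_measure_pmf)
    finally show ?thesis .
  qed
  then show ?thesis
    using meas by (simp add: has_law_def)
qed

lemma jep_law_subsets:
  assumes "0 < p" "p \<le> 1" and "A \<in> subsets_of_card n"
  shows "set_pmf (jep_law (geometric_pmf p) A t) \<subseteq> subsets_of_card n"
proof
  fix B assume B: "B \<in> set_pmf (jep_law (geometric_pmf p) A t)"
  have fin: "finite A" and "card A = n"
    using assms by (auto simp: subsets_of_card_def)
  have "inj_on (\<lambda>a. a - t) {a \<in> A. t \<le> a}"
    by (auto simp: inj_on_def)
  then have "card (down_shift {a \<in> A. t \<le> a} t) = card {a \<in> A. t \<le> a}"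
    unfolding down_shift_def by (rule card_image)
  moreover have "card {a \<in> A. t \<le> a} + card {a \<in> A. a < t} = card ({a \<in> A. t \<le> a} \<union> {a \<in> A. a < t})"
    using fin by (intro card_Un_disjoint[symmetric]) auto
  moreover have "{a \<in> A. t \<le> a} \<union> {a \<in> A. a < t} = A"
    by auto
  moreover have "finite (down_shift {a \<in> A. t \<le> a} t)"
    using fin by (simp add: down_shift_def)
  ultimately show "B \<in> subsets_of_card n"
    using random_fill_card B \<open>card A = n\<close> jep_law_eq_random_fill[OF assms(1,2) fin, of t]
    by (fastforce simp: subsets_of_card_def)
qed

lemma jep_has_law:
  assumes \<alpha>: "0 < \<alpha>" "\<alpha> < 1" and A: "A \<in> subsets_of_card n"
    and chain: "juggler_exclusion_process M n (memoryless \<alpha>) X"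
    and init: "AE \<omega> in M. X 0 \<omega> = A"
  shows "has_law M (subsets_of_card n) (X t) (jep_law (geometric_pmf (1 - \<alpha>)) A t)"
proof (induction t)
  case 0
  let ?S = "subsets_of_card n"
  have mc: "markov_chain M ?S (jep_trans (memoryless \<alpha>)) X"
    using chain by (simp add: juggler_exclusion_process_def)
  then interpret prob_space M
    by (simp add: markov_chain_def)
  have meas: "X 0 \<in> measurable M (count_space ?S)"
    using mc by (simp add: markov_chain_def)
  have "emeasure M {\<omega> \<in> space M. X 0 \<omega> = b} = pmf (return_pmf A) b" if b: "b \<in> ?S" for b
  proof -
    have "{\<omega> \<in> space M. X 0 \<omega> = b} \<in> sets M"
      using measurable_sets[OF meas, of "{b}"] b
      by (simp add: vimage_def Int_def conj_commute)
    then have "emeasure M {\<omega> \<in> space M. X 0 \<omega> = b} = emeasure M {\<omega> \<in> space M. A = b}"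
      using init by (intro emeasure_eq_AE) (auto elim: eventually_mono)
    then show ?thesis
      by (auto simp: emeasure_space_1 indicator_def)
  qed
  then show ?case
    using meas by (simp add: has_law_def)
next
  case (Suc t)
  then show ?case
    using chain jep_law_subsets[of "1 - \<alpha>" A n t] A \<alpha>
    unfolding jep_law.simps juggler_exclusion_process_def
    by (intro markov_chain_has_law_Suc[where P = "jep_trans (memoryless \<alpha>)"] jep_trans_eq_pmf_jep_step)
       (auto simp: subsets_of_card_def)
qed

section \<open>The law of a noncolliding union of independent points\<close>

lemma nc_union_eq_foldl: "nc_union A x k = foldl occupy A (map x [1..<Suc k])"
  by (induction k) (auto simp: Let_def occupy_def)

lemma pmf_replicate_pmf:
  "length xs = k \<Longrightarrow> pmf (replicate_pmf k p) xs = (\<Prod>i<k. pmf p (xs ! i))"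
proof (induction k arbitrary: xs)
  case (Suc k)
  then obtain y ys where xs: "xs = y # ys" and "length ys = k"
    by (cases xs) auto
  have "replicate_pmf (Suc k) p = map_pmf (\<lambda>(x, xs). x # xs) (pair_pmf p (replicate_pmf k p))"
    by (simp add: pair_pmf_def map_pmf_def bind_assoc_pmf bind_return_pmf)
  moreover have "inj (\<lambda>(x, xs). x # xs)"
    by (auto simp: inj_def)
  ultimately have "pmf (replicate_pmf (Suc k) p) xs = pmf (pair_pmf p (replicate_pmf k p)) (y, ys)"
    unfolding xs using pmf_map_inj'[of "\<lambda>(x, xs). x # xs" _ "(y, ys)"] by simp
  also have "\<dots> = (\<Prod>i<Suc k. pmf p (xs ! i))"
    using Suc.IH[OF \<open>length ys = k\<close>] by (simp add: pmf_pair xs prod.lessThan_Suc_shift del: prod.lessThan_Suc)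
  finally show ?case .
qed simp

text \<open>
  The joint law of the independent points. They are collected in a list, whose type is countable,
  so that every function of it is measurable and the noncolliding union can be treated as a plain
  function on lists.
\<close>
lemma has_law_list:
  fixes \<xi> :: "nat \<Rightarrow> 'v \<Rightarrow> nat"
  assumes "prob_space N" and indep: "prob_space.indep_vars N (\<lambda>_. count_space UNIV) \<xi> {1..n}"
    and law: "\<And>i m. i \<in> {1..n} \<Longrightarrow> \<P>(\<omega> in N. \<xi> i \<omega> = m) = pmf g m"
    and k: "k \<le> n"
  shows "has_law N UNIV (\<lambda>\<omega>. map (\<lambda>i. \<xi> i \<omega>) [1..<Suc k]) (replicate_pmf k g)"
proof -
  interpret prob_space N by fact
  let ?L = "\<lambda>\<omega>. map (\<lambda>i. \<xi> i \<omega>) [1..<Suc k]"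
  have meas: "\<xi> i \<in> measurable N (count_space UNIV)" if "i \<in> {1..n}" for i
    using indep that by (auto simp: indep_vars_def)
  have event: "{\<omega> \<in> space N. ?L \<omega> = xs} =
      {\<omega> \<in> space N. \<forall>i\<in>{1..k}. \<xi> i \<omega> = xs ! (i - 1)}" if "length xs = k" for xs
  proof -
    have "?L \<omega> = xs \<longleftrightarrow> (\<forall>i\<in>{1..k}. \<xi> i \<omega> = xs ! (i - 1))" for \<omega>
    proof -
      have "?L \<omega> = xs \<longleftrightarrow> (\<forall>j<k. \<xi> (Suc j) \<omega> = xs ! j)"
        using that by (auto simp: list_eq_iff_nth_eq simp del: upt_Suc)
      also have "\<dots> \<longleftrightarrow> (\<forall>i\<in>Suc ` {..<k}. \<xi> i \<omega> = xs ! (i - 1))"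
        by auto
      also have "Suc ` {..<k} = {1..k}"
        by (simp add: image_Suc_lessThan)
      finally show ?thesis .
    qed
    then show ?thesis
      by simp
  qed
  have none: "{\<omega> \<in> space N. ?L \<omega> = xs} = {}" if "length xs \<noteq> k" for xs
    using that by (auto simp del: upt_Suc)
  have "{\<omega> \<in> space N. ?L \<omega> = xs} \<in> sets N" for xs
  proof (cases "length xs = k")
    case True
    have "{\<omega> \<in> space N. \<xi> i \<omega> = m} \<in> sets N" if "i \<in> {1..k}" for i m
      using measurable_sets[OF meas, of i "{m}"] that k
      by (simp add: vimage_def Int_def conj_commute)
    then show ?thesis
      unfolding event[OF True] by (intro sets.sets_Collect_finite_All) auto
  next
    case False
    then show ?thesis
      by (simp only: none sets.empty_sets not_False_eq_True)
  qed
  then have "?L \<in> measurable N (count_space UNIV)"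
    by (subst measurable_count_space_eq2_countable)
       (auto simp: vimage_def Int_def conj_commute simp del: upt_Suc)
  moreover have "prob {\<omega> \<in> space N. ?L \<omega> = xs} = pmf (replicate_pmf k g) xs" for xs
  proof (cases "length xs = k")
    case True
    have "prob {\<omega> \<in> space N. ?L \<omega> = xs} = (\<Prod>i\<in>{1..k}. pmf g (xs ! (i - 1)))"
    proof (cases "k = 0")
      case True
      then show ?thesis
        using \<open>length xs = k\<close> by (simp add: prob_space)
    next
      case False
      have "{\<omega> \<in> space N. ?L \<omega> = xs} = (\<Inter>i\<in>{1..k}. \<xi> i -` {xs ! (i - 1)} \<inter> space N)"
        unfolding event[OF True] using False by auto
      then have "prob {\<omega> \<in> space N. ?L \<omega> = xs} =
          (\<Prod>i\<in>{1..k}. prob (\<xi> i -` {xs ! (i - 1)} \<inter> space N))"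
        using False k by (simp only:) (intro indep_varsD[OF indep], auto)
      also have "\<dots> = (\<Prod>i\<in>{1..k}. pmf g (xs ! (i - 1)))"
      proof (rule prod.cong[OF refl])
        fix i assume "i \<in> {1..k}"
        then have "i \<in> {1..n}"
          using k by simp
        from law[OF this] show "prob (\<xi> i -` {xs ! (i - 1)} \<inter> space N) = pmf g (xs ! (i - 1))"
          by (simp add: vimage_def Int_def conj_commute)
      qed
      finally show ?thesis .
    qed
    also have "\<dots> = (\<Prod>i<k. pmf g (xs ! i))"
      by (rule prod.reindex_bij_witness[of _ Suc "\<lambda>i. i - 1"]) auto
    finally show ?thesis
      using True by (simp add: pmf_replicate_pmf)
  next
    case False
    then have "xs \<notin> set_pmf (replicate_pmf k g)"
      by (simp add: set_replicate_pmf)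
    then show ?thesis
      unfolding none[OF False] by (simp add: set_pmf_iff)
  qed
  ultimately show ?thesis
    by (simp add: has_law_def emeasure_eq_measure del: upt_Suc)
qed

lemma has_law_comp:
  fixes L :: "'w \<Rightarrow> 'a::countable"
  assumes L: "has_law M UNIV L p" and F: "\<And>\<omega>. \<omega> \<in> space M \<Longrightarrow> F (L \<omega>) \<in> S"
  shows "has_law M S (\<lambda>\<omega>. F (L \<omega>)) (map_pmf F p)"
proof -
  have meas: "L \<in> measurable M (count_space UNIV)"
    using L by (simp add: has_law_def)
  have "distr M (count_space UNIV) L = distr (measure_pmf p) (count_space UNIV) (\<lambda>x. x)"
  proof (rule measure_eqI_countable[where A = UNIV])
    fix x
    have "L -` {x} \<inter> space M = {\<omega> \<in> space M. L \<omega> = x}"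
      by auto
    then show "emeasure (distr M (count_space UNIV) L) {x} =
        emeasure (distr (measure_pmf p) (count_space UNIV) (\<lambda>x. x)) {x}"
      using L by (simp add: has_law_def emeasure_distr emeasure_pmf_single)
  qed auto
  then have distr: "emeasure M (L -` Q \<inter> space M) = emeasure (measure_pmf p) Q" for Q
    using emeasure_distr[OF meas, of Q] by (simp add: emeasure_distr)
  have "emeasure M {\<omega> \<in> space M. F (L \<omega>) = b} = pmf (map_pmf F p) b" for b
  proof -
    have "{\<omega> \<in> space M. F (L \<omega>) = b} = L -` (F -` {b}) \<inter> space M"
      by auto
    then show ?thesis
      by (simp add: distr emeasure_pmf_single[symmetric] map_pmf_rep_eq emeasure_distr)
  qed
  moreover have "(\<lambda>\<omega>. F (L \<omega>)) \<in> measurable M (count_space S)"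
  proof (rule measurableI)
    fix B
    have "(\<lambda>\<omega>. F (L \<omega>)) -` B \<inter> space M = L -` (F -` B) \<inter> space M"
      by auto
    then show "(\<lambda>\<omega>. F (L \<omega>)) -` B \<inter> space M \<in> sets M"
      using measurable_sets[OF meas, of "F -` B"] by simp
  qed (simp add: F)
  ultimately show ?thesis
    by (simp add: has_law_def)
qed

lemma nc_union_has_law:
  assumes "prob_space N" and "prob_space.indep_vars N (\<lambda>_. count_space UNIV) \<xi> {1..n}"
    and "\<And>i m. i \<in> {1..n} \<Longrightarrow> \<P>(\<omega> in N. \<xi> i \<omega> = m) = pmf g m"
    and "k \<le> n" and "finite A" and "card A + k = m"
  shows "has_law N (subsets_of_card m) (\<lambda>\<omega>. nc_union A (\<lambda>i. \<xi> i \<omega>) k) (random_fill g A k)"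
  unfolding nc_union_eq_foldl random_fill_def
  using assms by (intro has_law_comp has_law_list)
    (auto simp: subsets_of_card_def card_foldl_occupy simp del: upt_Suc)

section \<open>Landing times\<close>

lemma del_smallest_0 [simp]: "del_smallest 0 A = A"
  by (simp add: del_smallest_def)

lemma del_smallest_Suc: "del_smallest (Suc k) A = del_min (del_smallest k A)"
  by (simp add: del_smallest_def)

lemma
  assumes "finite A" and "k \<le> card A"
  shows del_smallest_subset: "del_smallest k A \<subseteq> A"
    and card_del_smallest: "card (del_smallest k A) = card A - k"
proof -
  have "del_smallest k A \<subseteq> A \<and> card (del_smallest k A) = card A - k"
    using assms(2)
  proof (induction k)
    case (Suc k)
    let ?B = "del_smallest k A"
    have B: "?B \<subseteq> A" "card ?B = card A - k"
      using Suc by auto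
    then have "finite ?B" and "?B \<noteq> {}"
      using assms(1) Suc.prems finite_subset by auto
    then show ?case
      using B Suc.prems by (auto simp: del_smallest_Suc del_min_def)
  qed simp
  then show "del_smallest k A \<subseteq> A" and "card (del_smallest k A) = card A - k"
    by auto
qed

text \<open>
  The minima that are deleted one after the other increase, so \<open>tau A k\<close> lies beyond all of the
  first \<open>k\<close> of them.
\<close>
lemma less_if_deleted:
  assumes A: "finite A" and "k \<le> card A" and "a \<in> A" and "a \<notin> del_smallest k A"
  shows "a < tau A k"
  using assms(2,4)
proof (induction k)
  case (Suc k)
  let ?B = "del_smallest k A"
  have B: "?B \<subseteq> A" "card ?B = card A - k"
    using del_smallest_subset[OF A, of k] card_del_smallest[OF A, of k] Suc.prems by auto
  then have fin: "finite ?B" and "?B \<noteq> {}"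
    using A Suc.prems finite_subset by auto
  show ?case
  proof (cases "a \<in> ?B")
    case True
    then show ?thesis
      using Suc.prems by (auto simp: del_smallest_Suc del_min_def tau_def)
  next
    case False
    have "k \<noteq> 0"
      using False assms(3) by (cases k) auto
    then obtain j where j: "k = Suc j"
      by (cases k) auto
    have "?B \<subseteq> del_smallest j A" and "finite (del_smallest j A)"
      using del_smallest_subset[OF A, of j] Suc.prems A finite_subset
      by (auto simp: j del_smallest_Suc del_min_def)
    then have "Min (del_smallest j A) \<le> Min ?B"
      using \<open>?B \<noteq> {}\<close> by (intro Min_antimono) auto
    then show ?thesis
      using Suc.IH False Suc.prems by (simp add: tau_def j)
  qed
qed (use assms in simp)

text \<open>
  Between \<open>tau A k\<close> and \<open>tau A (k + 1)\<close> exactly the \<open>k\<close> smallest particles lie below \<open>t\<close>. Leaving out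
  the lower bound for \<open>k = 0\<close> and the upper bound for \<open>k = n\<close> puts the three cases of the theorem
  into one.
\<close>
lemma jep_law_between:
  assumes p: "0 < p" "p \<le> 1" and A: "A \<in> subsets_of_card n" and k: "k \<le> n"
    and after: "k \<noteq> 0 \<Longrightarrow> tau A k \<le> t" and before: "k \<noteq> n \<Longrightarrow> t < tau A (k + 1)"
  shows "jep_law (geometric_pmf p) A t = random_fill (geometric_pmf p) (down_shift (del_smallest k A) t) k"
    and "card (down_shift (del_smallest k A) t) + k = n"
proof -
  have fin: "finite A" and card: "card A = n"
    using A by (auto simp: subsets_of_card_def)
  let ?B = "del_smallest k A"
  have B: "?B \<subseteq> A" "card ?B = n - k" "finite ?B"
    using del_smallest_subset[OF fin, of k] card_del_smallest[OF fin, of k] fin k card finite_subset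
    by auto
  have late: "t \<le> a" if "a \<in> ?B" for a
  proof -
    have "k \<noteq> n"
      using B that by auto
    then have "t \<le> Min ?B"
      using before by (simp add: tau_def)
    then show ?thesis
      using B that by (meson Min_le le_trans)
  qed
  have early: "a < t" if "a \<in> A" "a \<notin> ?B" for a
    using less_if_deleted[OF fin, of k a] that after k card by (cases "k = 0") auto
  have "{a \<in> A. t \<le> a} = ?B" and lt: "{a \<in> A. a < t} = A - ?B"
    using late early B by (fastforce simp: not_less)+
  moreover have "card (A - ?B) = k"
    using B k card by (simp add: card_Diff_subset)
  ultimately show "jep_law (geometric_pmf p) A t =
      random_fill (geometric_pmf p) (down_shift ?B t) k"
    by (simp add: jep_law_eq_random_fill[OF p fin])
  have "inj_on (\<lambda>a. a - t) ?B"
    using late by (auto simp: inj_on_def dest!: late)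
  then show "card (down_shift ?B t) + k = n"
    using B k by (simp add: down_shift_def card_image)
qed

theorem theorem3p7:
  fixes n :: nat and \<alpha> :: real and A :: "nat set"
    and M :: "'w measure" and X :: "nat \<Rightarrow> 'w \<Rightarrow> nat set"
    and N :: "'v measure" and \<xi> :: "nat \<Rightarrow> 'v \<Rightarrow> nat"
    and t :: nat
  assumes "n \<ge> 1" and "0 < \<alpha>" and "\<alpha> < 1"
    and "A \<in> subsets_of_card n"
    and "juggler_exclusion_process M n (memoryless \<alpha>) X"
    and "AE \<omega> in M. X 0 \<omega> = A"
    and "prob_space N"
    and "prob_space.indep_vars N (\<lambda>_. count_space UNIV) \<xi> {1..n}"
    and "\<And>i m. i \<in> {1..n} \<Longrightarrow> \<P>(\<omega> in N. \<xi> i \<omega> = m) = (1 - \<alpha>) * \<alpha> ^ m"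
  shows "(t < tau A 1 \<longrightarrow>
            same_distribution (subsets_of_card n) M (X t) N (\<lambda>\<omega>. down_shift A t)) \<and>
         (\<forall>k\<in>{1..n-1}. tau A k \<le> t \<and> t < tau A (k + 1) \<longrightarrow>
            same_distribution (subsets_of_card n) M (X t)
              N (\<lambda>\<omega>. nc_union (down_shift (del_smallest k A) t) (\<lambda>i. \<xi> i \<omega>) k)) \<and>
         (t \<ge> tau A n \<longrightarrow>
            same_distribution (subsets_of_card n) M (X t) N (\<lambda>\<omega>. nc_union {} (\<lambda>i. \<xi> i \<omega>) n))"
proof -
  let ?S = "subsets_of_card n" and ?g = "geometric_pmf (1 - \<alpha>)"
  have fin: "finite A" and card: "card A = n"
    using assms(4) by (auto simp: subsets_of_card_def)
  have countable: "countable ?S"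
    using assms(5) by (simp add: juggler_exclusion_process_def markov_chain_def)
  have law: "\<P>(\<omega> in N. \<xi> i \<omega> = m) = pmf ?g m" if "i \<in> {1..n}" for i m
    using assms that by simp
  \<comment> \<open>For \<open>k = 0\<close> and \<open>k = n\<close> this is the first and the last case of the claim, since then
    no points are inserted and no element of \<open>A\<close> is left, respectively.\<close>
  have main: "same_distribution ?S M (X t) N
      (\<lambda>\<omega>. nc_union (down_shift (del_smallest k A) t) (\<lambda>i. \<xi> i \<omega>) k)"
    if k: "k \<le> n" "k \<noteq> 0 \<Longrightarrow> tau A k \<le> t" "k \<noteq> n \<Longrightarrow> t < tau A (k + 1)" for k
  proof (rule same_distribution_if_has_law[OF countable])
    have p: "0 < 1 - \<alpha>" "1 - \<alpha> \<le> 1"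
      using assms(2,3) by auto
    note between = jep_law_between[OF p assms(4) k]
    show "has_law M ?S (X t) (random_fill ?g (down_shift (del_smallest k A) t) k)"
      using jep_has_law[OF assms(2-6), of t] between(1) by simp
    have "finite (down_shift (del_smallest k A) t)"
      using del_smallest_subset[OF fin, of k] k(1) fin card finite_subset
      by (auto simp: down_shift_def)
    then show "has_law N ?S (\<lambda>\<omega>. nc_union (down_shift (del_smallest k A) t) (\<lambda>i. \<xi> i \<omega>) k)
        (random_fill ?g (down_shift (del_smallest k A) t) k)"
      using between(2) k(1) by (intro nc_union_has_law[OF assms(7,8) law])
  qed
  have "del_smallest n A = {}"
    using card_del_smallest[OF fin, of n] del_smallest_subset[OF fin, of n] fin card finite_subset
    by fastforce
  then have "down_shift (del_smallest n A) t = {}"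
    by (simp add: down_shift_def)
  then show ?thesis
    using main[of 0] main[of n] main assms(1) by auto
qed

end
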